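(* There exists a $7$-fold colouring of $G_{[1,1]}$ with $37$ colours; that is, $\chi_7(G_{[1,1]})\le 37$.
   Context: $G_{[1,1]}$ is the unit distance graph: vertex set $\mathbb{R}^2$, two points adjacent if and only if their Euclidean distance is exactly $1$. For positive integers $j\le k$, a $j$-fold colouring of a graph $G=(V,E)$ with $k$ colours is a map $f$ assigning to each vertex a $j$-element subset of $\{1,\dots,k\}$ such that $f(v)\cap f(w)=\emptyset$ whenever $v,w$ are adjacent; $\chi_j(G)$ is the least such $k$. *)

theory Defs
  imports "HOL-Analysis.Analysis" "HOL-Library.Extended_Nat"
begin

text \<open>A graph is given by its vertex set and its adjacency relation.\<close>

type_synonym 'v graph = "'v set \<times> ('v \<Rightarrow> 'v \<Rightarrow> bool)"

definition unit_distance_graph :: "(real ^ 2) graph" where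
  "unit_distance_graph = (UNIV, \<lambda>v w. dist v w = 1)"

definition fold_colouring :: "nat \<Rightarrow> nat \<Rightarrow> 'v graph \<Rightarrow> ('v \<Rightarrow> nat set) \<Rightarrow> bool" where
  "fold_colouring j k G f \<longleftrightarrow>
     1 \<le> j \<and> j \<le> k \<and>
     (\<forall>v\<in>fst G. f v \<subseteq> {1..k} \<and> card (f v) = j) \<and>
     (\<forall>v\<in>fst G. \<forall>w\<in>fst G. snd G v w \<longrightarrow> f v \<inter> f w = {})"

text \<open>The value is \<open>\<infinity>\<close> if no number of colours suffices; otherwise the infimum
  is attained, so it is the least such number of colours.\<close>

definition fold_chromatic_number :: "nat \<Rightarrow> 'v graph \<Rightarrow> enat" where
  "fold_chromatic_number j G = Inf {enat k | k. \<exists>f. fold_colouring j k G f}"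

end

theory Submission
  imports Defs
begin

text \<open>
  Cover the plane by the discs of radius $2/11$ around the points of the triangular lattice of
  minimal distance $2 \sqrt 3 / 11$, in which the point with coordinates $(x, y)$ has squared
  length $12 (x^2 + xy + y^2) / 121$. The residue of $x + 11 y$ modulo $37$ is the class of that
  lattice point; its kernel is the sublattice of index $37$ generated by $(4, 3)$ and $(-3, 7)$.
  Attach every point of the plane to a lattice point whose disc contains it, and
  give it the classes of this lattice point and of its six neighbours. Two points at distance
  $1$ are attached to lattice points whose mutual distance lies in $[7/11, 15/11]$, that is, whose
  difference satisfies $5 \le x^2 + xy + y^2 \le 18$. If they shared a colour, this difference
  would be congruent modulo the sublattice to a vector with $x^2 + xy + y^2 \le 4$; a finite
  check excludes that.
\<close>

text \<open>Polymorphic, since it is applied to real coordinates as well as to integer differences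
  of lattice points.\<close>

definition hex_norm :: "'a::comm_ring_1 \<Rightarrow> 'a \<Rightarrow> 'a" where
  "hex_norm x y = x^2 + x * y + y^2"

definition hex_point :: "real \<Rightarrow> real \<Rightarrow> real ^ 2" where
  "hex_point a b = vector [2 * sqrt 3 / 11 * (a + b / 2), 3 / 11 * b]"

lemma hex_point_diff: "hex_point a b - hex_point c d = hex_point (a - c) (b - d)"
  by (simp add: hex_point_def vec_eq_iff forall_2 algebra_simps diff_divide_distrib)

lemma norm_hex_point: "(norm (hex_point a b))\<^sup>2 = 12 / 121 * hex_norm a b"
  by (simp add: hex_point_def hex_norm_def norm_vec_def L2_set_def sum_2 power_mult_distrib
      power_divide) (simp add: power2_eq_square field_simps)

lemma hex_point_surj: "\<exists>a b. v = hex_point a b"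
proof (intro exI)
  show "v = hex_point (11 / (2 * sqrt 3) * v $ 1 - 11 / 6 * v $ 2) (11 / 3 * v $ 2)"
    by (simp add: hex_point_def vec_eq_iff forall_2 field_simps)
qed

text \<open>Weighting the squared distances to the vertices by the barycentric coordinates
  $\alpha, \beta, \gamma$ of the point yields $\alpha\beta + \beta\gamma + \gamma\alpha \le 1/3$.\<close>

lemma hex_norm_triangle:
  fixes u v :: real
  assumes "0 \<le> u" "0 \<le> v" "u + v \<le> 1"
  shows "hex_norm u v \<le> 1/3 \<or> hex_norm (u - 1) v \<le> 1/3 \<or> hex_norm u (v - 1) \<le> 1/3"
proof (rule ccontr)
  define w where "w = 1 - u - v"
  assume "\<not> ?thesis"
  then have gt: "hex_norm u v > 1/3" "hex_norm (u - 1) v > 1/3" "hex_norm u (v - 1) > 1/3"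
    by auto
  define A B C where "A = w * (hex_norm u v - 1/3)" and "B = u * (hex_norm (u - 1) v - 1/3)"
    and "C = v * (hex_norm u (v - 1) - 1/3)"
  have ge: "A \<ge> 0" "B \<ge> 0" "C \<ge> 0"
    using gt assms by (simp_all add: A_def B_def C_def w_def)
  define S where "S = (w - u)\<^sup>2 + (u - v)\<^sup>2 + (v - w)\<^sup>2"
  have "A + B + C = - S / 6"
    by (simp add: A_def B_def C_def S_def w_def hex_norm_def power2_eq_square field_simps)
  moreover have "S \<ge> 0" by (simp add: S_def)
  ultimately have "A + B + C \<le> 0" by linarith
  then have "A = 0" "B = 0" "C = 0" using ge by linarith+
  then have "w = 0" "u = 0" "v = 0" using gt by (auto simp: A_def B_def C_def)
  then show False by (simp add: w_def)
qed

lemma hex_norm_covering: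
  fixes a b :: real
  shows "\<exists>(x::int) (y::int). hex_norm (a - x) (b - y) \<le> 1/3"
proof -
  define u v where "u = frac a" and "v = frac b"
  have a: "a = u + \<lfloor>a\<rfloor>" and b: "b = v + \<lfloor>b\<rfloor>" by (simp_all add: u_def v_def frac_def)
  have range: "0 \<le> u" "u < 1" "0 \<le> v" "v < 1" by (simp_all add: u_def v_def frac_lt_1)
  have *: "\<exists>(x::int) (y::int). hex_norm (a - x) (b - y) \<le> 1/3"
    if "hex_norm (u - of_int i) (v - of_int j) \<le> 1/3" for i j
  proof (intro exI)
    have "a - of_int (\<lfloor>a\<rfloor> + i) = u - of_int i" "b - of_int (\<lfloor>b\<rfloor> + j) = v - of_int j"
      using a b by simp_all
    then show "hex_norm (a - of_int (\<lfloor>a\<rfloor> + i)) (b - of_int (\<lfloor>b\<rfloor> + j)) \<le> 1/3"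
      using that by (simp only:)
  qed
  show ?thesis
  proof (cases "u + v \<le> 1")
    case True
    with hex_norm_triangle[of u v] range show ?thesis
      using *[of 0 0] *[of 1 0] *[of 0 1] by auto
  next
    case False
    \<comment> \<open>The diagonal cuts the unit cell into two triangles; the reflection sending
      (\<open>u\<close>, \<open>v\<close>) to (\<open>1 - u\<close>, \<open>1 - v\<close>) carries
      the upper one to the lower one.\<close>
    have "hex_norm (-p) (-q) = hex_norm p q" for p q :: real
      by (simp add: hex_norm_def)
    from this[of "u - 1" "v - 1"] this[of u "v - 1"] this[of "u - 1" v]
    show ?thesis
      using hex_norm_triangle[of "1 - u" "1 - v"] range False *[of 1 1] *[of 0 1] *[of 1 0]
      by auto
  qed
qed

lemma hex_point_covering: "\<exists>(x::int) (y::int). dist v (hex_point x y) \<le> 2/11"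
proof -
  obtain a b where v: "v = hex_point a b" using hex_point_surj by blast
  obtain x y :: int where xy: "hex_norm (a - x) (b - y) \<le> 1/3" using hex_norm_covering by blast
  \<comment> \<open>The scale is chosen so that \<open>12/121 * 1/3 = (2/11)^2\<close>.\<close>
  have "(dist v (hex_point x y))\<^sup>2 \<le> (2/11)\<^sup>2"
    using xy by (simp add: v dist_norm hex_point_diff norm_hex_point power_divide)
  then have "dist v (hex_point x y) \<le> 2/11" by (rule power2_le_imp_le) simp
  then show ?thesis by blast
qed

lemma hex_norm_unit_dist:
  fixes x y x' y' :: int
  assumes "dist v w = 1" "dist v (hex_point x y) \<le> 2/11" "dist w (hex_point x' y') \<le> 2/11"
  shows "hex_norm (x - x') (y - y') \<in> {5..18}"
proof -
  define p q d where "p = hex_point x y" and "q = hex_point x' y'" and "d = dist p q"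
  have "dist v w \<le> dist v p + d + dist w q" "d \<le> dist v p + dist v w + dist w q"
    unfolding d_def
    using dist_triangle[of v w p] dist_triangle[of p w q] dist_triangle[of p q v]
      dist_triangle[of v q w]
    by (simp_all add: dist_commute)
  then have "7/11 \<le> d" "d \<le> 15/11"
    using assms by (simp_all add: p_def q_def)
  then have "(7/11)\<^sup>2 \<le> d\<^sup>2" "d\<^sup>2 \<le> (15/11)\<^sup>2"
    by (simp_all add: power_mono)
  moreover have "d\<^sup>2 = 12 / 121 * real_of_int (hex_norm (x - x') (y - y'))"
    by (simp add: d_def p_def q_def dist_norm hex_point_diff norm_hex_point) (simp add: hex_norm_def)
  \<comment> \<open>The bounds on the norm are 49/12 > 4 and 225/12 < 19; integrality sharpens them
    to 5 and 18.\<close>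
  ultimately show ?thesis by (simp add: power2_eq_square)
qed

text \<open>The values of $x + 11 y$ where $x^2 + xy + y^2 \le 1$.\<close>

definition offsets :: "int set" where
  "offsets = {0, 1, -1, 11, -11, 10, -10}"

text \<open>Completing the square gives \<open>3 * x^2 \<le> 72\<close>. This makes the later check
  finite; symmetry of \<open>hex_norm\<close> bounds \<open>y\<close> too.\<close>

lemma hex_norm_le_imp_abs_le:
  fixes x y :: int
  assumes "hex_norm x y \<le> 18"
  shows "\<bar>x\<bar> \<le> 4"
proof -
  have "3 * x^2 + (x + 2 * y)^2 = 4 * hex_norm x y"
    by (simp add: hex_norm_def power2_eq_square algebra_simps)
  moreover have "(x + 2 * y)^2 \<ge> 0" by simp
  ultimately have "x^2 < 25" using assms by linarith
  then have "\<bar>x\<bar>^2 < 5^2" by simp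
  then have "\<bar>x\<bar> < 5" by (rule power2_less_imp_less) simp
  then show ?thesis by simp
qed

text \<open>The residues modulo 37 of \<open>s - r\<close> for offsets \<open>r\<close>,
  \<open>s\<close>; equivalently, the classes of the 19 lattice vectors with \<open>hex_norm\<close>
  at most 4.\<close>

definition offset_differences :: "int set" where
  "offset_differences =
     {0, 1, 36, 2, 35, 9, 28, 10, 27, 11, 26, 12, 25, 20, 17, 21, 16, 22, 15}"

lemma mod_in_offset_differences:
  assumes "r \<in> offsets" "s \<in> offsets" "(c + r - s) mod 37 = 0"
  shows "c mod 37 \<in> offset_differences"
proof -
  have "c mod 37 = (s - r) mod 37"
    using assms(3) mod_eq_dvd_iff[of c 37 "s - r"] by (simp add: dvd_eq_mod_eq_0 algebra_simps)
  then show ?thesis using assms(1,2) by (auto simp: offsets_def offset_differences_def)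
qed

lemma class_notin_offset_differences:
  "\<forall>x\<in>{-4..4}. \<forall>y\<in>{-4..4}. hex_norm x y \<in> {5..18} \<longrightarrow>
     (x + 11 * y) mod 37 \<notin> offset_differences"
proof -
  \<comment> \<open>Listing the interval turns the claim into 81 numerical instances.\<close>
  have "{-4..4::int} = {-4, -3, -2, -1, 0, 1, 2, 3, 4}" by auto
  then show ?thesis by (simp add: hex_norm_def offset_differences_def)
qed

lemma class_offsets_disjoint:
  fixes x y :: int
  assumes "hex_norm x y \<in> {5..18}" "r \<in> offsets" "s \<in> offsets"
  shows "(x + 11 * y + r - s) mod 37 \<noteq> 0"
proof -
  have "hex_norm y x = hex_norm x y" by (simp add: hex_norm_def)
  then have "x \<in> {-4..4}" "y \<in> {-4..4}"
    using hex_norm_le_imp_abs_le[of x y] hex_norm_le_imp_abs_le[of y x] assms(1)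
    by auto
  then have "(x + 11 * y) mod 37 \<notin> offset_differences"
    using class_notin_offset_differences assms(1) by simp
  then show ?thesis using mod_in_offset_differences[OF assms(2,3), of "x + 11 * y"] by auto
qed

text \<open>Adding 1 moves the residues 0 to 36 into the palette \<open>{1..37}\<close>.\<close>

definition colours :: "int \<Rightarrow> nat set" where
  "colours c = (\<lambda>r. nat ((c + r) mod 37) + 1) ` offsets"

lemma colours_subset: "colours c \<subseteq> {1..37}"
  by (auto simp: colours_def Suc_le_eq nat_less_iff)

lemma colours_eq_imp_mod:
  assumes "nat ((c + r) mod 37) + 1 = nat ((c' + r') mod 37) + 1"
  shows "((c - c') + r - r') mod (37::int) = 0"
proof -
  have "(c + r) mod 37 = (c' + r') mod 37"
    using assms by (simp add: eq_nat_nat_iff)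
  then have "37 dvd (c + r) - (c' + r')" by (rule mod_eq_dvd_iff[THEN iffD1])
  then show ?thesis by (simp add: dvd_eq_mod_eq_0 algebra_simps)
qed

text \<open>Two offsets differ by at most 22 in absolute value, so distinct ones stay distinct
  modulo 37.\<close>

lemma card_colours: "card (colours c) = 7"
proof -
  have "inj_on (\<lambda>r. nat ((c + r) mod 37) + 1) offsets"
  proof (rule inj_onI)
    fix r s
    assume rs: "r \<in> offsets" "s \<in> offsets"
      and "nat ((c + r) mod 37) + 1 = nat ((c + s) mod 37) + 1"
    then have "(r - s) mod 37 = 0" using colours_eq_imp_mod[of c r c s] by simp
    with rs show "r = s" by (auto simp: offsets_def)
  qed
  then show ?thesis by (simp add: colours_def card_image) (simp add: offsets_def)
qed

lemma colours_disjoint: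
  assumes "hex_norm (x - x') (y - y') \<in> {5..18}"
  shows "colours (x + 11 * y) \<inter> colours (x' + 11 * y') = {}"
proof (rule ccontr)
  assume "\<not> ?thesis"
  then obtain r s where rs: "r \<in> offsets" "s \<in> offsets"
    and "nat ((x + 11 * y + r) mod 37) + 1 = nat ((x' + 11 * y' + s) mod 37) + 1"
    by (auto simp: colours_def)
  then have "(x + 11 * y - (x' + 11 * y') + r - s) mod 37 = 0"
    by (intro colours_eq_imp_mod)
  \<comment> \<open>The class is linear, so only the difference of the lattice points
    matters.\<close>
  moreover have "x + 11 * y - (x' + 11 * y') = (x - x') + 11 * (y - y')" by simp
  ultimately show False using class_offsets_disjoint[OF assms rs] by simp
qed

lemma fold_chromatic_number_le:
  assumes "fold_colouring j k G f"
  shows "fold_chromatic_number j G \<le> enat k"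
  unfolding fold_chromatic_number_def using assms by (intro Inf_lower) blast

theorem theorem5:
  shows "(\<exists>f. fold_colouring 7 37 unit_distance_graph f) \<and>
         fold_chromatic_number 7 unit_distance_graph \<le> 37"
proof -
  \<comment> \<open>The discs overlap; any choice of a centre for each point will do.\<close>
  obtain X Y :: "real ^ 2 \<Rightarrow> int" where XY: "dist v (hex_point (X v) (Y v)) \<le> 2/11" for v
    using hex_point_covering by metis
  have "fold_colouring 7 37 unit_distance_graph (\<lambda>v. colours (X v + 11 * Y v))"
    unfolding fold_colouring_def unit_distance_graph_def
    using colours_subset card_colours colours_disjoint[OF hex_norm_unit_dist[OF _ XY XY]]
    by simp
  then show ?thesis using fold_chromatic_number_le[of 7 37 unit_distance_graph]
    by (auto simp: numeral_eq_enat)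
qed

end
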